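(* Let $q\ge2$ be an integer and define $$\Lambda_q^{\mathrm{Rat}} = \begin{cases} \big((0, \tfrac{\pi}{\log 2}) \cap \tfrac{\pi}{\log 2}\mathbb{Q}\big) \setminus \{\tfrac{3\pi}{4\log 2}, \tfrac{5\pi}{12\log 2}, \tfrac{11\pi}{12\log 2}\} & \text{if } q = 2,\\ \big((0, \tfrac{\pi}{\log 3}) \cap \tfrac{\pi}{\log 3}\mathbb{Q}\big) \setminus \{\tfrac{5\pi}{6\log 3}\} & \text{if } q = 3,\\ (0, \tfrac{\pi}{\log q}) \cap \tfrac{\pi}{\log q}\mathbb{Q} & \text{if } q \geq 4. \end{cases}$$ Let $\mu$ be an invariant locally square-integrable point process on the $(q+1)$-regular tree $\mathbb{T}_{q+1}$ with diffraction measure $\sigma_\mu$, and suppose that there is a $\lambda\in\Lambda_q^{\mathrm{Rat}}$ such that $\sigma_\mu(\{\lambda\})>0$. Then $$\liminf_{r \to +\infty} \frac{\mathrm{NV}_\mu^*(r)}{|B_r(o)|} > 0 .$$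
   Context: Fix an integer $q\ge2$. $\mathbb{T}_{q+1}$ denotes (the vertex set of) the $(q+1)$-regular tree with graph metric $d$ and root $o$; $B_r(o)=\{x: d(x,o)\le r\}$ for integers $r\ge0$. A point process on $\mathbb{T}_{q+1}$ is a Borel probability measure $\mu$ on the space $\mathscr{M}_+(\mathbb{T}_{q+1})$ of positive locally finite measures $p$ on $\mathbb{T}_{q+1}$ (identified with functions $p:\mathbb{T}_{q+1}\to\mathbb{R}_{\ge0}$, topology of pointwise convergence). It is invariant if it is invariant under the push-forward action of $\operatorname{Aut}(\mathbb{T}_{q+1})$, and locally square-integrable if $\int p(\{x\})^2\,d\mu(p)<\infty$ for all vertices $x$. For finitely supported $f:\mathbb{T}_{q+1}\to\mathbb{C}$ put $\mathbb{S}f(p)=\sum_x p(\{x\})f(x)$. For $\lambda\in\mathbb{C}$, $\omega_\lambda$ is the unique function on $\mathbb{T}_{q+1}$ that depends only on $d(x,o)$, has $\omega_\lambda(o)=1$, and satisfies $\sum_{y\sim x}\omega_\lambda(y)=2\sqrt q\cos(\lambda\log q)\,\omega_\lambda(x)$ for all $x$ (the spherical function). For finitely supported radial $f$ (i.e. depending only on $d(x,o)$) set $\hat f(\lambda)=\sum_x f(x)\omega_\lambda(x)$. Let $\Lambda_q=i[0,\tfrac12]\cup(0,\tfrac{\pi}{\log q})\cup(\tfrac{\pi}{\log q}+i[0,\tfrac12])\subset\mathbb{C}$ and $\Lambda_q^*=\Lambda_q\setminus\{\tfrac i2,\tfrac{\pi}{\log q}+\tfrac i2\}$. The diffraction measure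 of an invariant locally square-integrable point process $\mu$ is the unique positive finite Borel measure $\sigma_\mu$ on $\Lambda_q$ such that $\int \mathbb{S}f_1\,\overline{\mathbb{S}f_2}\,d\mu=\int_{\Lambda_q}\hat f_1(\lambda)\overline{\hat f_2(\lambda)}\,d\sigma_\mu(\lambda)$ for all finitely supported radial $f_1,f_2$ (its existence and uniqueness are taken as known). The sub-oscillatory number variance is, for integers $r\ge0$, $$\mathrm{NV}^*_\mu(r)=\int_{\Lambda_q^*}|\hat\chi_{B_r(o)}(\lambda)|^2d\sigma_\mu(\lambda)=q^r\int_{\Lambda_q^*}\frac{\big(\sin(\lambda(r+1)\log q)+q^{-1/2}\sin(\lambda r\log q)\big)^2}{\sin^2(\lambda\log q)}\,d\sigma_\mu(\lambda),$$ where $\chi_{B_r(o)}$ is the indicator function of $B_r(o)$ and the integrand is extended by continuity to $\lambda\in\{0,\tfrac{\pi}{\log q}\}$. *)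

theory Defs
  imports "HOL-Probability.Probability"
begin

text \<open>Graphs are given by their adjacency relation on a whole type of vertices. A cycle is a list
  of at least three distinct vertices, consecutive ones (cyclically) being adjacent.\<close>

definition is_tree :: "('v \<Rightarrow> 'v \<Rightarrow> bool) \<Rightarrow> bool" where
  "is_tree E \<longleftrightarrow>
     (\<forall>x. \<not> E x x) \<and> (\<forall>x y. E x y \<longrightarrow> E y x) \<and>
     (\<forall>x y. E\<^sup>*\<^sup>* x y) \<and>
     \<not> (\<exists>xs. 3 \<le> length xs \<and> distinct xs \<and> successively E xs \<and> E (last xs) (hd xs))"

definition is_regular :: "nat \<Rightarrow> ('v \<Rightarrow> 'v \<Rightarrow> bool) \<Rightarrow> bool" where
  "is_regular k E \<longleftrightarrow> (\<forall>x. finite {y. E x y} \<and> card {y. E x y} = k)"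

definition gdist :: "('v \<Rightarrow> 'v \<Rightarrow> bool) \<Rightarrow> 'v \<Rightarrow> 'v \<Rightarrow> nat" where
  "gdist E x y = (LEAST n. (E ^^ n) x y)"

definition gball :: "('v \<Rightarrow> 'v \<Rightarrow> bool) \<Rightarrow> 'v \<Rightarrow> nat \<Rightarrow> 'v set" where
  "gball E c r = {x. gdist E x c \<le> r}"

definition automorphism :: "('v \<Rightarrow> 'v \<Rightarrow> bool) \<Rightarrow> ('v \<Rightarrow> 'v) \<Rightarrow> bool" where
  "automorphism E g \<longleftrightarrow> bij g \<and> (\<forall>x y. E (g x) (g y) \<longleftrightarrow> E x y)"

definition radial :: "('v \<Rightarrow> 'v \<Rightarrow> bool) \<Rightarrow> 'v \<Rightarrow> ('v \<Rightarrow> complex) \<Rightarrow> bool" where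
  "radial E c f \<longleftrightarrow> (\<forall>x y. gdist E x c = gdist E y c \<longrightarrow> f x = f y)"

definition finitely_supported :: "('v \<Rightarrow> complex) \<Rightarrow> bool" where
  "finitely_supported f \<longleftrightarrow> finite {x. f x \<noteq> 0}"

text \<open>A locally finite positive measure on the (discrete) vertex set is identified with its weight
  function \<open>x \<mapsto> p({x})\<close>. The type \<open>'v \<Rightarrow> real\<close> carries the topology of pointwise convergence
  (theory Function-Topology), and \<open>borel\<close> is its Borel sigma-algebra.\<close>

definition point_process :: "('v \<Rightarrow> real) measure \<Rightarrow> bool" where
  "point_process M \<longleftrightarrow>
     prob_space M \<and> sets M = sets (restrict_space borel {p. \<forall>x. 0 \<le> p x})"

text \<open>In terms of weight functions the push-forward of \<open>p\<close> under \<open>g\<close> is \<open>p \<circ> g\<^sup>-\<^sup>1\<close>.\<close>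

definition invariant_process :: "('v \<Rightarrow> 'v \<Rightarrow> bool) \<Rightarrow> ('v \<Rightarrow> real) measure \<Rightarrow> bool" where
  "invariant_process E M \<longleftrightarrow>
     (\<forall>g. automorphism E g \<longrightarrow> distr M M (\<lambda>p. p \<circ> inv g) = M)"

definition locally_square_integrable :: "('v \<Rightarrow> real) measure \<Rightarrow> bool" where
  "locally_square_integrable M \<longleftrightarrow> (\<forall>x. integrable M (\<lambda>p. (p x)\<^sup>2))"

definition linear_statistic :: "('v \<Rightarrow> complex) \<Rightarrow> ('v \<Rightarrow> real) \<Rightarrow> complex" where
  "linear_statistic f p = (\<Sum>x | f x \<noteq> 0. complex_of_real (p x) * f x)"

definition spherical ::
  "nat \<Rightarrow> ('v \<Rightarrow> 'v \<Rightarrow> bool) \<Rightarrow> 'v \<Rightarrow> complex \<Rightarrow> 'v \<Rightarrow> complex" where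
  "spherical q E c l = (THE w. radial E c w \<and> w c = 1 \<and>
     (\<forall>x. (\<Sum>y | E x y. w y) =
          2 * complex_of_real (sqrt (real q)) * cos (l * complex_of_real (ln (real q))) * w x))"

definition spherical_transform ::
  "nat \<Rightarrow> ('v \<Rightarrow> 'v \<Rightarrow> bool) \<Rightarrow> 'v \<Rightarrow> ('v \<Rightarrow> complex) \<Rightarrow> complex \<Rightarrow> complex" where
  "spherical_transform q E c f l = (\<Sum>x | f x \<noteq> 0. f x * spherical q E c l x)"

definition Lambda :: "nat \<Rightarrow> complex set" where
  "Lambda q =
     (\<lambda>t. \<i> * complex_of_real t) ` {0..1/2} \<union>
     complex_of_real ` {0<..<pi / ln (real q)} \<union>
     (\<lambda>t. complex_of_real (pi / ln (real q)) + \<i> * complex_of_real t) ` {0..1/2}"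

definition Lambda_star :: "nat \<Rightarrow> complex set" where
  "Lambda_star q = Lambda q - {\<i> / 2, complex_of_real (pi / ln (real q)) + \<i> / 2}"

text \<open>The diffraction measure is unique, so it is rendered by its defining property.\<close>

definition is_diffraction_measure ::
  "nat \<Rightarrow> ('v \<Rightarrow> 'v \<Rightarrow> bool) \<Rightarrow> 'v \<Rightarrow> ('v \<Rightarrow> real) measure \<Rightarrow> complex measure \<Rightarrow> bool" where
  "is_diffraction_measure q E c M \<sigma> \<longleftrightarrow>
     finite_measure \<sigma> \<and> sets \<sigma> = sets (restrict_space borel (Lambda q)) \<and>
     (\<forall>f1 f2. finitely_supported f1 \<and> radial E c f1 \<and> finitely_supported f2 \<and> radial E c f2 \<longrightarrow>
        (LINT p|M. linear_statistic f1 p * cnj (linear_statistic f2 p)) =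
        (LINT l|\<sigma>. spherical_transform q E c f1 l * cnj (spherical_transform q E c f2 l)))"

definition NV_star ::
  "nat \<Rightarrow> ('v \<Rightarrow> 'v \<Rightarrow> bool) \<Rightarrow> 'v \<Rightarrow> complex measure \<Rightarrow> nat \<Rightarrow> real" where
  "NV_star q E c \<sigma> r =
     (LINT l:Lambda_star q|\<sigma>. (cmod (spherical_transform q E c (indicator (gball E c r)) l))\<^sup>2)"

definition Lambda_rat :: "nat \<Rightarrow> real set" where
  "Lambda_rat q =
     (let R = {0<..<pi / ln (real q)} \<inter> (\<lambda>t. pi / ln (real q) * t) ` \<rat> in
      if q = 2 then R - {3 * pi / (4 * ln 2), 5 * pi / (12 * ln 2), 11 * pi / (12 * ln 2)}
      else if q = 3 then R - {5 * pi / (6 * ln 3)}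
      else R)"

end

theory Submission
  imports Defs "Jordan_Normal_Form.Char_Poly"
begin

text \<open>Put \<open>\<theta> = l log q\<close>. Up to the factor \<open>sin \<theta>\<close>, the spherical transform of the ball of radius \<open>r\<close>
  at \<open>l\<close> is \<open>q\<^sup>r\<^sup>/\<^sup>2\<close> times \<open>sin ((r + 1) \<theta>) + q\<^sup>-\<^sup>1\<^sup>/\<^sup>2 sin (r \<theta>)\<close>, which is periodic in \<open>r\<close> when \<open>\<theta>\<close> is a
  rational multiple of \<open>\<pi>\<close>. As balls have at most \<open>3 q\<^sup>r\<close> points, the atom at \<open>l\<close> alone gives a
  positive lower bound as soon as this expression never vanishes.

  A zero means \<open>q sin\<^sup>2 a = sin\<^sup>2 b\<close> with \<open>a = (r + 1) \<theta>\<close> and \<open>b = r \<theta>\<close>, that is,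
  \<open>(1 - y)\<^sup>2 x = q y (1 - x)\<^sup>2\<close> for the roots of unity \<open>x = exp (2ia)\<close> and \<open>y = exp (2ib)\<close>. If \<open>y\<close> has order
  \<open>m\<close>, then \<open>q\<close> divides every \<open>(1 - y\<^sup>j)\<^sup>2\<close> in the ring generated by a common root of unity. The
  product of \<open>1 - y\<^sup>j\<close> over \<open>0 < j < m\<close> is \<open>m\<close>, so \<open>q\<^sup>m\<^sup>-\<^sup>1\<close> divides \<open>m\<^sup>2\<close>, which leaves
  only \<open>(m, q) = (2, 2), (2, 4), (3, 3), (4, 2)\<close>. These give the excluded values of \<open>l\<close>.\<close>

subsection \<open>Roots of unity and ratios of sines\<close>

text \<open>The vector \<open>v\<close> is a nonzero eigenvector of the integer matrix
  \<open>c\<close> for the eigenvalue \<open>w\<close>, so \<open>w\<close> is a root of the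
  characteristic polynomial, which is monic with integer coefficients.\<close>

lemma algebraic_int_if_integral_linear_system:
  fixes w :: complex and v :: "nat \<Rightarrow> complex" and c :: "nat \<Rightarrow> nat \<Rightarrow> int"
  assumes "\<And>i. i < n \<Longrightarrow> w * v i = (\<Sum>j<n. of_int (c i j) * v j)"
    and "i0 < n" "v i0 \<noteq> 0"
  shows "algebraic_int w"
proof -
  define M :: "int mat" where "M = mat n n (\<lambda>(i, j). c i j)"
  define u where "u = vec n v"
  have M: "M \<in> carrier_mat n n" by (simp add: M_def)
  have Mc: "map_mat complex_of_int M \<in> carrier_mat n n" by (simp add: M_def)
  have "eigenvector (map_mat complex_of_int M) u w"
    unfolding eigenvector_def
  proof (intro conjI)
    show "u \<in> carrier_vec (dim_row (map_mat complex_of_int M))"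
      by (simp add: u_def M_def)
    show "u \<noteq> 0\<^sub>v (dim_row (map_mat complex_of_int M))"
      using assms(2,3) by (metis index_vec index_zero_vec(1) u_def M Mc carrier_matD(1))
    show "map_mat complex_of_int M *\<^sub>v u = w \<cdot>\<^sub>v u"
      by (rule eq_vecI)
        (auto simp: u_def M_def scalar_prod_def assms(1) lessThan_atLeast0 intro!: sum.cong)
  qed
  then have "poly (char_poly (map_mat complex_of_int M)) w = 0"
    using eigenvalue_root_char_poly[OF Mc] by (auto simp: eigenvalue_def)
  then have "poly (map_poly of_int (char_poly M)) w = 0"
    by (simp add: of_int_hom.char_poly_hom[OF M])
  moreover have "lead_coeff (char_poly M) = 1"
    using degree_monic_char_poly[OF M] by auto
  ultimately show ?thesis
    unfolding algebraic_int_altdef_ipoly by blast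
qed

text \<open>If \<open>z ^ n = 1\<close>, this is the ring Z[z]: exponents below \<open>n\<close>
  suffice. The powers may be linearly dependent, so no minimal polynomial enters.\<close>

definition int_span_powers :: "nat \<Rightarrow> complex \<Rightarrow> complex set" where
  "int_span_powers n z = range (\<lambda>a :: nat \<Rightarrow> int. \<Sum>k<n. of_int (a k) * z ^ k)"

context
  fixes n :: nat and z :: complex
  assumes n_pos: "n > 0" and root: "z ^ n = 1"
begin

lemma int_span_powers_add:
  assumes "u \<in> int_span_powers n z" "v \<in> int_span_powers n z"
  shows "u + v \<in> int_span_powers n z"
proof -
  obtain a b where "u = (\<Sum>k<n. of_int (a k) * z ^ k)" "v = (\<Sum>k<n. of_int (b k) * z ^ k)"
    using assms by (auto simp: int_span_powers_def)
  then have "u + v = (\<Sum>k<n. of_int (a k + b k) * z ^ k)"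
    by (simp add: sum.distrib ring_distribs)
  then show ?thesis
    unfolding int_span_powers_def by (rule range_eqI[where x = "\<lambda>k. a k + b k"])
qed

lemma int_span_powers_of_int_mult:
  assumes "u \<in> int_span_powers n z"
  shows "of_int i * u \<in> int_span_powers n z"
proof -
  obtain a where "u = (\<Sum>k<n. of_int (a k) * z ^ k)"
    using assms by (auto simp: int_span_powers_def)
  then have "of_int i * u = (\<Sum>k<n. of_int (i * a k) * z ^ k)"
    by (simp add: sum_distrib_left mult.assoc)
  then show ?thesis
    unfolding int_span_powers_def by (rule range_eqI[where x = "\<lambda>k. i * a k"])
qed

lemma int_span_powers_power: "z ^ k \<in> int_span_powers n z"
proof -
  have "z ^ k = z ^ (k mod n + n * (k div n))" by simp
  also have "\<dots> = z ^ (k mod n)"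
    by (simp only: power_add power_mult root) simp
  also have "\<dots> = (\<Sum>j<n. of_int (if j = k mod n then 1 else 0) * z ^ j)"
    using n_pos by (subst sum.cong[OF refl, of _ _ "\<lambda>j. if j = k mod n then z ^ j else 0"]) auto
  finally show ?thesis
    unfolding int_span_powers_def by (auto intro!: range_eqI[where x = "\<lambda>j. if j = k mod n then 1 else 0"])
qed

lemma int_span_powers_of_int: "of_int i \<in> int_span_powers n z"
  using int_span_powers_of_int_mult[OF int_span_powers_power[of 0], of i] by simp

lemma int_span_powers_sum:
  assumes "\<And>i. i \<in> I \<Longrightarrow> f i \<in> int_span_powers n z"
  shows "sum f I \<in> int_span_powers n z"
  using assms
proof (induction I rule: infinite_finite_induct)
  case (insert x F)
  then show ?case by (auto intro: int_span_powers_add)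
qed (use int_span_powers_of_int[of 0] in auto)

lemma int_span_powers_mult:
  assumes "u \<in> int_span_powers n z" "v \<in> int_span_powers n z"
  shows "u * v \<in> int_span_powers n z"
proof -
  obtain a b where "u = (\<Sum>k<n. of_int (a k) * z ^ k)" "v = (\<Sum>k<n. of_int (b k) * z ^ k)"
    using assms by (auto simp: int_span_powers_def)
  then have "u * v = (\<Sum>k<n. \<Sum>j<n. of_int (a k * b j) * z ^ (k + j))"
    by (simp add: sum_product power_add mult_ac)
  also have "\<dots> \<in> int_span_powers n z"
    by (intro int_span_powers_sum int_span_powers_of_int_mult int_span_powers_power)
  finally show ?thesis .
qed

lemma int_span_powers_prod:
  assumes "\<And>i. i \<in> I \<Longrightarrow> f i \<in> int_span_powers n z"
  shows "prod f I \<in> int_span_powers n z"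
  using assms
proof (induction I rule: infinite_finite_induct)
  case (insert x F)
  then show ?case by (auto intro: int_span_powers_mult)
qed (use int_span_powers_of_int[of 1] in auto)

lemma int_span_powers_diff:
  assumes "u \<in> int_span_powers n z" "v \<in> int_span_powers n z"
  shows "u - v \<in> int_span_powers n z"
  using int_span_powers_add[OF assms(1) int_span_powers_of_int_mult[OF assms(2), of "-1"]] by simp

text \<open>Multiplication by \<open>w\<close> maps the finitely generated group spanned by the
  powers of \<open>z\<close> into itself, so \<open>w\<close> is an algebraic integer. This turns
  divisibility in Z[z] into divisibility in Z.\<close>

lemma int_span_powers_Rats_imp_Ints:
  assumes "w \<in> int_span_powers n z" "w \<in> \<rat>"
  shows "w \<in> \<int>"
proof (rule rational_algebraic_int_is_int[OF _ assms(2)])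
  have "\<exists>a :: nat \<Rightarrow> int. w * z ^ i = (\<Sum>j<n. of_int (a j) * z ^ j)" for i
    using int_span_powers_mult[OF assms(1) int_span_powers_power[of i]]
    by (auto simp: int_span_powers_def)
  then obtain c :: "nat \<Rightarrow> nat \<Rightarrow> int"
    where "\<And>i. w * z ^ i = (\<Sum>j<n. of_int (c i j) * z ^ j)" by metis
  then show "algebraic_int w"
    by (rule algebraic_int_if_integral_linear_system[of n _ "\<lambda>i. z ^ i" _ 0]) (use n_pos in auto)
qed

end

section \<open>Possible orders of the root of unity\<close>

text \<open>The powers \<open>y ^ j\<close> with 0 < j < m are the nontrivial \<open>m\<close>-th
  roots of unity, so the product of the X - y^j is 1 + X + ... + X^(m-1). Evaluate at 1.\<close>

lemma prod_one_minus_powers_primitive_root: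
  fixes y :: complex
  assumes m: "m > 0" "y ^ m = 1" and min: "\<And>k. 0 < k \<Longrightarrow> k < m \<Longrightarrow> y ^ k \<noteq> 1"
  shows "(\<Prod>j\<in>{1..<m}. 1 - y ^ j) = of_nat m"
proof -
  have y0: "y \<noteq> 0" using m by (auto simp: power_0_left)
  have inj: "inj_on (\<lambda>j. y ^ j) {..<m}"
  proof (rule inj_onI)
    have *: "i = j" if "i \<le> j" "j < m" "y ^ i = y ^ j" for i j
    proof (rule ccontr)
      assume "i \<noteq> j"
      have "y ^ i * y ^ (j - i) = y ^ i * 1"
        using that by (metis le_add_diff_inverse mult_1_right power_add)
      then have "y ^ (j - i) = 1" using y0 by simp
      then show False using min[of "j - i"] that \<open>i \<noteq> j\<close> by auto
    qed
    show "i = j" if "i \<in> {..<m}" "j \<in> {..<m}" "y ^ i = y ^ j" for i j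
      using *[of i j] *[of j i] that by (metis lessThan_iff nle_le)
  qed
  define P where "P = (\<Prod>j\<in>{1..<m}. [:- (y ^ j), 1:])"
  define Q where "Q = (\<Sum>i<m. monom (1 :: complex) i)"
  have deg_P: "degree P = m - 1" and lead_P: "lead_coeff P = 1"
    unfolding P_def by (subst degree_prod_eq_sum_degree; simp) (simp add: lead_coeff_prod)
  have "P = Q"
  \<comment> \<open>Degree at most \<open>m - 1\<close>, equal coefficients there and agreement at
    \<open>m - 1\<close> points force equality.\<close>
  proof (rule poly_eqI_degree_lead_coeff)
    show "poly.coeff P (m - 1) = poly.coeff Q (m - 1)"
      using lead_P deg_P m(1) by (simp add: Q_def coeff_sum)
    have "inj_on (\<lambda>j. y ^ j) {1..<m}" by (rule inj_on_subset[OF inj]) auto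
    then show "m - 1 \<le> card ((\<lambda>j. y ^ j) ` {1..<m})"
      by (simp add: card_image)
    show "degree P \<le> m - 1" by (simp add: deg_P)
    show "degree Q \<le> m - 1"
      unfolding Q_def by (rule degree_sum_le) (auto intro: order.trans[OF degree_monom_le])
    fix x assume "x \<in> (\<lambda>j. y ^ j) ` {1..<m}"
    then obtain j where j: "j \<in> {1..<m}" "x = y ^ j" by auto
    have "x ^ m = (y ^ m) ^ j"
      unfolding j(2) power_mult[symmetric] by (simp only: mult.commute)
    with j have "x \<noteq> 1" "x ^ m = 1" using min[of j] m(2) by auto
    then have "poly Q x = 0"
      using power_diff_1_eq[of x m] by (simp add: Q_def poly_sum poly_monom)
    moreover have "poly P x = 0"
      unfolding P_def poly_prod using j by (intro prod_zero bexI[of _ j]) auto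
    ultimately show "poly P x = poly Q x" by simp
  qed
  then have "poly P 1 = poly Q 1" by simp
  then show ?thesis by (simp add: P_def Q_def poly_prod poly_sum poly_monom)
qed

lemma power_pred_dvd_square:
  fixes q m :: nat
  assumes "q \<ge> 2" "m \<ge> 2" "q ^ (m - 1) dvd m ^ 2"
  shows "(m = 2 \<and> q = 2) \<or> (m = 2 \<and> q = 4) \<or> (m = 3 \<and> q = 3) \<or> (m = 4 \<and> q = 2)"
proof -
  have le: "q ^ (m - 1) \<le> m ^ 2" using assms by (intro dvd_imp_le) auto
  \<comment> \<open>The threshold 7 is the least possible: 49 < 64, whereas 36 > 32. The orders 2 to
    6 are checked one by one.\<close>
  have "k ^ 2 < 2 ^ (k - 1)" if "k \<ge> 7" for k :: nat
    using that
  proof (induction k rule: dec_induct)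
    case (step k)
    have "7 * k \<le> k * k" using step by (intro mult_right_mono) auto
    then have "Suc k ^ 2 < 2 * k ^ 2"
      using step(1) unfolding power2_eq_square by (simp, linarith)
    then show ?case using step by (cases k) auto
  qed simp
  moreover have "2 ^ (m - 1) \<le> q ^ (m - 1)" using assms by (intro power_mono) auto
  ultimately have "m < 7" using le by (meson not_le order.strict_trans1)
  then consider "m = 2" | "m = 3" | "m = 4" | "m = 5" | "m = 6" using assms by linarith
  then show ?thesis
  proof cases
    case 1
    then have "q dvd 4" using assms by simp
    moreover from this have "q \<le> 4" by (rule dvd_imp_le) simp
    ultimately have "q = 2 \<or> q = 4" using assms(1) by (cases "q = 3") auto
    then show ?thesis using 1 by simp
  next
    case 2
    have "\<not> q \<ge> 4" using power_mono[of 4 q 2] le 2 by auto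
    then have "q = 2 \<or> q = 3" using assms(1) by auto
    then have "q = 3" using assms(3) 2 by auto
    then show ?thesis using 2 by simp
  next
    case 3
    have "\<not> q \<ge> 3" using power_mono[of 3 q 3] le 3 by auto
    then show ?thesis using 3 assms(1) by simp
  next
    case 4
    have "\<not> q \<ge> 3" using power_mono[of 3 q 4] le 4 by auto
    then have "q = 2" using assms(1) by simp
    then show ?thesis using 4 assms(3) by simp
  next
    case 5
    have "\<not> q \<ge> 3" using power_mono[of 3 q 5] le 5 by auto
    then have "q = 2" using assms(1) by simp
    then show ?thesis using 5 assms(3) by simp
  qed
qed

text \<open>Writing \<open>x\<close> and \<open>y\<close> as powers of one \<open>z\<close> keeps
  the divisibility argument in a single ring. The three alternatives say that \<open>y\<close> has
  order 2, 3 or 4.\<close>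

lemma one_minus_roots_of_unity_scaled:
  fixes z :: complex
  assumes q: "q \<ge> 2" and n: "n > 0" "z ^ n = 1" and x: "x = z ^ k" and y: "y = z ^ l" "y \<noteq> 1"
    and eq: "(1 - y) ^ 2 * x = of_nat q * y * (1 - x) ^ 2"
  shows "((q = 2 \<or> q = 4) \<and> y = -1) \<or> (q = 3 \<and> y ^ 2 + y + 1 = 0) \<or> (q = 2 \<and> y ^ 2 = -1)"
proof -
  let ?S = "int_span_powers n z"
  note S_power = int_span_powers_power[OF n] and S_mult = int_span_powers_mult[OF n]
    and S_diff = int_span_powers_diff[OF n] and S_sum = int_span_powers_sum[OF n]
  have "(z ^ i) ^ n = (z ^ n) ^ i" for i
    unfolding power_mult[symmetric] by (simp only: mult.commute)
  then have xn: "x ^ n = 1" and yn: "y ^ n = 1"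
    using n(2) by (simp_all add: x y(1))
  have x_inv: "x * x ^ (n - 1) = 1" using xn n(1) by (cases n) auto
  define m where "m = (LEAST m. m > 0 \<and> y ^ m = 1)"
  have m: "m > 0" "y ^ m = 1"
    using LeastI[of "\<lambda>m. m > 0 \<and> y ^ m = 1" n] n(1) yn by (auto simp: m_def)
  have m_min: "y ^ i \<noteq> 1" if "0 < i" "i < m" for i
    using not_less_Least[of i "\<lambda>m. m > 0 \<and> y ^ m = 1"] that by (auto simp: m_def)
  have "m \<noteq> 1" using m(2) y(2) by auto
  then have m2: "m \<ge> 2" using m(1) by linarith
  \<comment> \<open>The cofactor of \<open>q\<close> in \<open>(1 - y ^ j) ^ 2\<close>: solve
    \<open>eq\<close> for \<open>(1 - y) ^ 2\<close>, with \<open>x ^ (n - 1)\<close> as the inverse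
    of \<open>x\<close>, and multiply by the square of the geometric sum (1 - y^j) / (1 -
    y).\<close>
  define s where "s j = y * x ^ (n - 1) * (1 - x) ^ 2 * (\<Sum>i<j. y ^ i) ^ 2" for j :: nat
  have sS: "s j \<in> ?S" for j
  proof -
    have "(1 - x) \<in> ?S" using S_diff[OF S_power[of 0] S_power[of k]] by (simp add: x)
    moreover have "(\<Sum>i<j. y ^ i) \<in> ?S"
      by (intro S_sum) (simp add: y(1) S_power flip: power_mult)
    moreover have "x ^ (n - 1) \<in> ?S" "y \<in> ?S"
      by (simp_all add: x y(1) S_power flip: power_mult)
    ultimately show ?thesis
      unfolding s_def power2_eq_square by (intro S_mult)
  qed
  have s: "(1 - y ^ j) ^ 2 = of_nat q * s j" for j
  proof -
    have "(1 - y) ^ 2 = (1 - y) ^ 2 * x * x ^ (n - 1)"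
      by (simp only: mult.assoc x_inv mult_1_right)
    then have "(1 - y) ^ 2 = of_nat q * y * x ^ (n - 1) * (1 - x) ^ 2"
      unfolding eq by (simp only: mult_ac)
    then show ?thesis
      by (simp add: one_diff_power_eq power_mult_distrib s_def mult_ac)
  qed
  define W where "W = (\<Prod>j\<in>{1..<m}. s j)"
  have WS: "W \<in> ?S" unfolding W_def by (intro int_span_powers_prod[OF n] sS)
  have prod_root: "(\<Prod>j\<in>{1..<m}. 1 - y ^ j) = of_nat m"
    by (rule prod_one_minus_powers_primitive_root[OF m m_min])
  have "of_nat (m ^ 2) = (\<Prod>j\<in>{1..<m}. (1 - y ^ j) ^ 2)"
    by (simp only: prod_power_distrib[symmetric] prod_root of_nat_power)
  also have "\<dots> = of_nat (q ^ (m - 1)) * W"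
    by (simp add: s prod.distrib W_def)
  finally have mW: "of_nat (m ^ 2) = of_nat (q ^ (m - 1)) * W" .
  \<comment> \<open>As a quotient of integers \<open>W\<close> is rational, and it lies in Z[z],
    hence it is an integer.\<close>
  then have "W = of_nat (m ^ 2) / of_nat (q ^ (m - 1))" using q by (simp add: field_simps)
  then have "W \<in> \<rat>" by simp
  then obtain w :: int where "W = of_int w"
    using int_span_powers_Rats_imp_Ints[OF n WS] by (auto simp: Ints_def)
  then have "(of_int (int (m ^ 2)) :: complex) = of_int (int (q ^ (m - 1)) * w)"
    using mW by simp
  then have "int (m ^ 2) = int (q ^ (m - 1)) * w"
    by (simp only: of_int_eq_iff)
  then have "q ^ (m - 1) dvd m ^ 2" by (metis dvd_triv_left of_nat_dvd_iff)
  from power_pred_dvd_square[OF q m2 this]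
  consider "m = 2" "q = 2 \<or> q = 4" | "m = 3" "q = 3" | "m = 4" "q = 2" by blast
  then show ?thesis
  proof cases
    case 1
    then show ?thesis using m(2) y(2) by (auto simp: power2_eq_1_iff)
  next
    case 2
    have "(y - 1) * (y ^ 2 + y + 1) = 0"
      using m(2) 2 by (simp add: algebra_simps power2_eq_square power3_eq_cube)
    then show ?thesis using 2 y(2) by simp
  next
    case 3
    have "(y ^ 2) ^ 2 = 1" "y ^ 2 \<noteq> 1" using m(2) m_min[of 2] 3 by auto
    then have "y ^ 2 = -1" using power2_eq_1_iff[of "y ^ 2"] by blast
    then show ?thesis using 3 by simp
  qed
qed

section \<open>Zeros of the sine expression at rational angles\<close>

lemma one_minus_cis_square: "(1 - cis (2 * a)) ^ 2 = - 4 * of_real (sin a ^ 2) * cis (2 * a)"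
proof -
  have "(1 - cis (2 * a)) = cis a * (cis (- a) - cis a)"
    by (simp add: algebra_simps cis_mult)
  also have "cis (- a) - cis a = - 2 * \<i> * of_real (sin a)"
    by (simp add: complex_eq_iff)
  finally show ?thesis
    by (simp add: power_mult_distrib power2_eq_square cis_mult mult_ac)
qed

text \<open>For t = k/d both \<open>cis (2 * a)\<close> and \<open>cis (2 * b)\<close> are powers of
  a \<open>d\<close>-th root of unity, and the relation between the squared sines becomes the
  relation treated above. The order of \<open>cis (2 * b)\<close> then yields
  \<open>cos b ^ 2\<close> through its real part.\<close>

lemma sine_square_ratio_rational_angles:
  fixes a b t :: real and i j q :: nat
  assumes q: "q \<ge> 2" and t: "t \<in> \<rat>" "t > 0" and a: "a = real i * (pi * t)" and b: "b = real j * (pi * t)"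
    and eq: "sin b ^ 2 = real q * sin a ^ 2" and nz: "sin b \<noteq> 0"
  shows "((q = 2 \<or> q = 4) \<and> cos b ^ 2 = 0) \<or> (q = 3 \<and> cos b ^ 2 = 1 / 4) \<or> (q = 2 \<and> cos b ^ 2 = 1 / 2)"
proof -
  obtain k d :: nat where kd: "d > 0" "t = real k / real d"
    using t by (metis Rats_abs_nat_div_natE abs_of_pos gr0I)
  define z where "z = cis (2 * pi / d)"
  define y where "y = cis (2 * b)"
  have "z ^ d = cis (real d * (2 * pi / real d))" unfolding z_def by (rule Complex.DeMoivre)
  then have z: "z ^ d = 1" using kd(1) by simp
  have xz: "cis (2 * a) = z ^ (k * i)" and yz: "y = z ^ (k * j)"
    by (simp_all add: y_def z_def Complex.DeMoivre a b kd(2) mult_ac)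
  have "sin b ^ 2 > 0" using nz by simp
  have Re_y: "Re y = 2 * cos b ^ 2 - 1"
    by (simp add: y_def cos_double_cos)
  have "y \<noteq> 1"
  proof
    assume "y = 1"
    then have "cos b ^ 2 = 1" using Re_y by simp
    then show False using \<open>sin b ^ 2 > 0\<close> by (simp add: sin_squared_eq)
  qed
  moreover have "(1 - y) ^ 2 * cis (2 * a) = of_nat q * y * (1 - cis (2 * a)) ^ 2"
    unfolding y_def one_minus_cis_square eq by simp
  ultimately consider "q = 2 \<or> q = 4" "y = -1" | "q = 3" "y ^ 2 + y + 1 = 0" | "q = 2" "y ^ 2 = -1"
    using one_minus_roots_of_unity_scaled[OF q kd(1) z xz yz] by blast
  then show ?thesis
  proof cases
    case 1
    then show ?thesis using Re_y by simp
  next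
    case 2
    \<comment> \<open>Since \<open>y\<close> has modulus 1, multiplying by its conjugate leaves a
      linear equation for \<open>Re y\<close>.\<close>
    have "cnj y * (y ^ 2 + y + 1) = (y * cnj y) * y + y * cnj y + cnj y"
      by (simp add: algebra_simps power2_eq_square)
    moreover have "y * cnj y = 1" by (simp add: y_def cis_cnj cis_mult)
    ultimately have "y + 1 + cnj y = 0" using 2(2) by simp
    then have "2 * Re y + 1 = 0" by (auto dest: arg_cong[of _ _ Re])
    then show ?thesis using 2(1) Re_y by simp
  next
    case 3
    have "cis (4 * b) = -1" using 3(2) by (simp add: y_def Complex.DeMoivre)
    then have "cos (2 * (2 * b)) = -1" by (auto dest: arg_cong[of _ _ Re])
    then have "cos (2 * b) ^ 2 = 0" unfolding cos_double_cos[of "2 * b"] by simp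
    then have "cos (2 * b) = 0" by simp
    then show ?thesis using 3(1) by (simp add: cos_double_cos)
  qed
qed

lemma cos_5_pi_12: "cos (5 * pi / 12) = (sqrt 6 - sqrt 2) / 4"
proof -
  have "cos (5 * pi / 12) = cos (pi / 4 + pi / 6)" by (rule arg_cong[of _ _ cos]) simp
  also have "\<dots> = (sqrt 6 - sqrt 2) / 4"
    by (simp only: cos_add cos_45 cos_30 sin_45 sin_30)
      (simp add: field_simps flip: real_sqrt_mult)
  finally show ?thesis .
qed

lemma cos_11_pi_12: "cos (11 * pi / 12) = - (sqrt 6 + sqrt 2) / 4"
proof -
  have "cos (11 * pi / 12) = cos (pi - (pi / 4 - pi / 6))"
    by (rule arg_cong[of _ _ cos]) simp
  also have "\<dots> = - (sqrt 6 + sqrt 2) / 4"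
    by (simp only: cos_pi_minus cos_diff cos_45 cos_30 sin_45 sin_30)
      (simp add: field_simps flip: real_sqrt_mult)
  finally show ?thesis .
qed

text \<open>Since \<theta> = a - b and sin a is a multiple of sin b, the value of
  \<open>cos b ^ 2\<close> determines cos \<theta> up to the sign of cos a cos b. Each resulting
  cosine gives one angle in (0, pi), which is either excluded or contradicts b = r \<theta>.\<close>

lemma sine_recurrence_zero_rational_angle:
  fixes \<theta> t :: real and r q :: nat
  assumes q: "q \<ge> 2" and t: "t \<in> \<rat>" "0 < t" "t < 1" and \<theta>: "\<theta> = pi * t"
    and eq: "sin (real (r + 1) * \<theta>) + sin (real r * \<theta>) / sqrt q = 0"
  shows "(q = 2 \<and> \<theta> \<in> {3 * pi / 4, 5 * pi / 12, 11 * pi / 12}) \<or> (q = 3 \<and> \<theta> = 5 * pi / 6)"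
proof -
  define a where "a = real (r + 1) * \<theta>"
  define b where "b = real r * \<theta>"
  have range: "0 < \<theta>" "\<theta> < pi" using t by (simp_all add: \<theta>)
  have sin_a: "sin a = - sin b / sqrt q" using eq by (simp add: a_def b_def)
  have diff: "\<theta> = a - b" by (simp add: a_def b_def algebra_simps)
  have "sin b ^ 2 = real q * sin a ^ 2"
    using q by (simp add: sin_a power_divide)
  moreover have "sin b \<noteq> 0"
  proof
    assume "sin b = 0"
    then have "sin \<theta> = 0" using sin_a by (simp add: diff sin_diff)
    then show False using sin_gt_zero[OF range] by simp
  qed
  ultimately consider
    "q = 2" "cos b ^ 2 = 0" | "q = 4" "cos b ^ 2 = 0" | "q = 3" "cos b ^ 2 = 1 / 4" | "q = 2" "cos b ^ 2 = 1 / 2"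
    using sine_square_ratio_rational_angles[OF q t(1,2), of a "r + 1" b r]
    by (auto simp: a_def b_def \<theta>)
  note cases = this
  have cos_\<theta>: "cos \<theta> = cos a * cos b - (1 - cos b ^ 2) / sqrt q"
    unfolding diff cos_diff sin_squared_eq[symmetric] by (simp add: sin_a power2_eq_square)
  have cos_a: "cos a ^ 2 = 1 - (1 - cos b ^ 2) / real q"
    by (simp add: cos_squared_eq sin_a power_divide)
  have \<theta>_eqI: "\<theta> = u" if "cos \<theta> = cos u" "0 < u" "u < pi" for u
    using cos_inj_pi[of \<theta> u] that range by simp
  show ?thesis
    using cases
  proof cases
    case 1
    have "cos \<theta> = - 1 / sqrt 2" using cos_\<theta> 1 by simp
    also have "\<dots> = cos (pi - pi / 4)" unfolding cos_pi_minus cos_45 by (simp add: field_simps)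
    also have "pi - pi / 4 = 3 * pi / 4" by simp
    finally have "\<theta> = 3 * pi / 4" by (intro \<theta>_eqI) auto
    then show ?thesis using 1 by simp
  next
    case 2
    \<comment> \<open>No exception arises for q = 4: this angle makes 3b a multiple of pi, so sin
      (3b) = 0, but cos b = 0 gives sin (3b) = - sin b, which is nonzero.\<close>
    have "cos \<theta> = cos (2 * pi / 3)" using cos_\<theta> 2 by (simp add: cos_120)
    then have "\<theta> = 2 * pi / 3" by (intro \<theta>_eqI) auto
    then have "sin (3 * b) = sin (real (2 * r) * pi)"
      by (intro arg_cong[of _ _ sin]) (simp add: b_def)
    also have "\<dots> = 0" by (rule sin_npi)
    finally have "sin (2 * b + b) = 0" by simp
    then have "sin (2 * b) * cos b + cos (2 * b) * sin b = 0" by (simp only: sin_add)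
    moreover have "cos b = 0" using 2 by simp
    ultimately show ?thesis using \<open>sin b \<noteq> 0\<close> by (simp add: cos_double_cos)
  next
    case 3
    have "(cos a * cos b) ^ 2 = (sqrt 3 / 4) ^ 2"
      unfolding power_mult_distrib cos_a 3 by (simp add: power_divide)
    then consider "cos a * cos b = sqrt 3 / 4" | "cos a * cos b = - (sqrt 3 / 4)"
      unfolding power2_eq_iff by blast
    moreover have cos_\<theta>': "cos \<theta> = cos a * cos b - sqrt 3 / 4"
      unfolding cos_\<theta> 3 by (simp add: real_div_sqrt field_simps)
    ultimately show ?thesis
    proof cases
      case 1
      \<comment> \<open>Here 2b is a multiple of pi, so sin b cos b = 0, although neither factor
        vanishes.\<close>
      then have "\<theta> = pi / 2" using cos_\<theta>' by (intro \<theta>_eqI) auto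
      then have "sin (2 * b) = sin (real r * pi)"
        by (intro arg_cong[of _ _ sin]) (simp add: b_def)
      also have "\<dots> = 0" by (rule sin_npi)
      finally have "cos b = 0" using \<open>sin b \<noteq> 0\<close> by (simp add: sin_double)
      then show ?thesis using 3 by simp
    next
      case 2
      then have "cos \<theta> = cos (pi - pi / 6)" using cos_\<theta>' unfolding cos_pi_minus cos_30 by simp
      also have "pi - pi / 6 = 5 * pi / 6" by simp
      finally have "\<theta> = 5 * pi / 6" by (intro \<theta>_eqI) auto
      then show ?thesis using 3 by simp
    qed
  next
    case 4
    \<comment> \<open>Now cos^2 a = 3/4 and cos^2 b = 1/2. The two signs of the product give the two
      angles with denominator 12.\<close>
    have "(cos a * cos b) ^ 2 = (sqrt 6 / 4) ^ 2"
      unfolding power_mult_distrib cos_a 4 by (simp add: power_divide)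
    then consider "cos a * cos b = sqrt 6 / 4" | "cos a * cos b = - (sqrt 6 / 4)"
      unfolding power2_eq_iff by blast
    moreover have cos_\<theta>': "cos \<theta> = cos a * cos b - sqrt 2 / 4"
      unfolding cos_\<theta> 4 by (simp add: real_div_sqrt field_simps)
    ultimately show ?thesis
    proof cases
      case 1
      then have "cos \<theta> = cos (5 * pi / 12)" using cos_\<theta>' by (simp add: cos_5_pi_12)
      then have "\<theta> = 5 * pi / 12" by (intro \<theta>_eqI) auto
      then show ?thesis using 4 by simp
    next
      case 2
      then have "cos \<theta> = cos (11 * pi / 12)" using cos_\<theta>' by (simp add: cos_11_pi_12)
      then have "\<theta> = 11 * pi / 12" by (intro \<theta>_eqI) auto
      then show ?thesis using 4 by simp
    qed
  qed
qed

text \<open>For t = k/d the expression has period 2d in \<open>r\<close>, because 2d \<theta> is a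
  multiple of 2 pi. The bound is its least absolute value over one period.\<close>

lemma sine_recurrence_bounded_below_rational_angle:
  fixes \<theta> t :: real
  assumes t: "t \<in> \<rat>" "0 < t" and \<theta>: "\<theta> = pi * t"
    and nz: "\<And>r :: nat. sin (real (r + 1) * \<theta>) + sin (real r * \<theta>) / s \<noteq> 0"
  obtains \<delta> where "\<delta> > 0" "\<And>r :: nat. \<delta> \<le> \<bar>sin (real (r + 1) * \<theta>) + sin (real r * \<theta>) / s\<bar>"
proof -
  obtain k d :: nat where kd: "d > 0" "t = real k / real d"
    using t by (metis Rats_abs_nat_div_natE abs_of_pos gr0I)
  define f where "f r = \<bar>sin (real (r + 1) * \<theta>) + sin (real r * \<theta>) / s\<bar>" for r :: nat
  have shift: "sin (real (n + 2 * d * i) * \<theta>) = sin (real n * \<theta>)" for n i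
  proof -
    have "sin (real (n + 2 * d * i) * \<theta>) = sin (real n * \<theta> + 2 * pi * real (k * i))"
      using kd by (intro arg_cong[of _ _ sin]) (simp add: \<theta> field_simps)
    also have "\<dots> = sin (real n * \<theta>)"
      using sin_int_2pin[of "int (k * i)"] cos_int_2pin[of "int (k * i)"] by (simp add: sin_add)
    finally show ?thesis .
  qed
  have period: "f r = f (r mod (2 * d))" for r
  proof -
    define i j where "i = r mod (2 * d)" and "j = r div (2 * d)"
    have r: "r = i + 2 * d * j" "r + 1 = (i + 1) + 2 * d * j" by (simp_all add: i_def j_def)
    have "sin (real r * \<theta>) = sin (real i * \<theta>)" unfolding r(1) by (rule shift)
    moreover have "sin (real (r + 1) * \<theta>) = sin (real (i + 1) * \<theta>)" unfolding r(2) by (rule shift)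
    ultimately show ?thesis unfolding f_def i_def[symmetric] by (simp only:)
  qed
  let ?M = "Min (f ` {..<2 * d})"
  have "f 0 \<in> f ` {..<2 * d}" using kd by simp
  then have ne: "f ` {..<2 * d} \<noteq> {}" by blast
  have "?M > 0" using ne nz by (subst Min_gr_iff) (auto simp: f_def)
  moreover have "?M \<le> f r" for r
    using kd by (subst period) (auto intro!: Min_le)
  ultimately show ?thesis using that unfolding f_def by blast
qed

subsection \<open>Spherical functions on a regular tree\<close>

text \<open>Loop erasure: when the walk returns to a vertex of the path built so far, the path is
  cut off there.\<close>

lemma simple_path_if_rtranclp_within:
  assumes "(\<lambda>a b. E a b \<and> b \<in> S)\<^sup>*\<^sup>* y z" "y \<in> S"
  shows "\<exists>xs. xs \<noteq> [] \<and> distinct xs \<and> successively E xs \<and> hd xs = y \<and> last xs = z \<and> set xs \<subseteq> S"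
  using assms(1)
proof (induction rule: rtranclp_induct)
  case base
  show ?case by (rule exI[of _ "[y]"]) (use assms(2) in auto)
next
  case (step w z)
  then obtain xs where xs: "xs \<noteq> []" "distinct xs" "successively E xs" "hd xs = y" "last xs = w" "set xs \<subseteq> S"
    by blast
  show ?case
  proof (cases "z \<in> set xs")
    case True
    then obtain as bs where "xs = as @ z # bs" by (meson split_list)
    then have "xs = (as @ [z]) @ bs" by simp
    then show ?thesis
      using xs by (intro exI[of _ "as @ [z]"]) (auto simp: successively_append_iff hd_append)
  next
    case False
    then show ?thesis
      using xs step(2) by (intro exI[of _ "xs @ [z]"]) (auto simp: successively_append_iff)
  qed
qed

locale regular_tree =
  fixes q :: nat and E :: "'v \<Rightarrow> 'v \<Rightarrow> bool" and c :: 'v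
  assumes tree: "is_tree E" and regular: "is_regular (q + 1) E" and q_pos: "q \<ge> 1"
begin

abbreviation d :: "'v \<Rightarrow> nat" where "d x \<equiv> gdist E x c"

definition sphere :: "nat \<Rightarrow> 'v set" where "sphere n = {x. d x = n}"

lemma irrefl: "\<not> E x x" and sym: "E x y \<Longrightarrow> E y x" and connected: "E\<^sup>*\<^sup>* x y"
  and no_cycle: "3 \<le> length xs \<Longrightarrow> distinct xs \<Longrightarrow> successively E xs \<Longrightarrow> \<not> E (last xs) (hd xs)"
  using tree unfolding is_tree_def by blast+

lemma finite_nbrs: "finite {y. E x y}" and card_nbrs: "card {y. E x y} = q + 1"
  using regular unfolding is_regular_def by auto

lemma relpowp_gdist: "(E ^^ d x) x c"
  unfolding gdist_def using rtranclp_imp_relpowp[OF connected[of x c]] by (rule LeastI_ex)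

lemma gdist_le: "(E ^^ n) x c \<Longrightarrow> d x \<le> n"
  unfolding gdist_def by (rule Least_le)

lemma gdist_self [simp]: "d c = 0"
  using gdist_le[of 0 c] by simp

lemma gdist_eq_0_iff [simp]: "d x = 0 \<longleftrightarrow> x = c"
  using relpowp_gdist[of x] by (cases "d x = 0") auto

lemma gdist_adj_le: "E x y \<Longrightarrow> d x \<le> Suc (d y)"
  by (rule gdist_le) (rule relpowp_Suc_I2[OF _ relpowp_gdist])

lemma ex_parent:
  assumes "d x = Suc n"
  shows "\<exists>y. E x y \<and> d y = n"
proof -
  obtain y where y: "E x y" "(E ^^ n) y c"
    using relpowp_gdist[of x] assms by (metis relpowp_Suc_D2)
  then show ?thesis using gdist_le[OF y(2)] gdist_adj_le[OF y(1)] assms by force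
qed

text \<open>Two neighbours of \<open>x\<close> inside a connected set avoiding \<open>x\<close> would close a cycle through \<open>x\<close>.\<close>

lemma unique_neighbour_in_connected_set:
  assumes S: "\<And>u v. u \<in> S \<Longrightarrow> v \<in> S \<Longrightarrow> (\<lambda>a b. E a b \<and> b \<in> S)\<^sup>*\<^sup>* u v"
    and x: "x \<notin> S" and y: "E x y" "y \<in> S" and z: "E x z" "z \<in> S"
  shows "y = z"
proof (rule ccontr)
  assume "y \<noteq> z"
  obtain xs where xs: "xs \<noteq> []" "distinct xs" "successively E xs" "hd xs = y" "last xs = z" "set xs \<subseteq> S"
    using simple_path_if_rtranclp_within[OF S[OF y(2) z(2)] y(2)] by blast
  have "2 \<le> length xs"
    using xs \<open>y \<noteq> z\<close> by (cases xs; cases "tl xs") auto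
  then have "3 \<le> length (x # xs)" by simp
  moreover have "distinct (x # xs)" using xs x by auto
  moreover have "successively E (x # xs)" using xs y(1) by (simp add: successively_Cons)
  ultimately have "\<not> E (last (x # xs)) (hd (x # xs))" by (rule no_cycle)
  then show False using xs z(1) sym by simp
qed

abbreviation "step_in S \<equiv> (\<lambda>a b. E a b \<and> b \<in> S)"

text \<open>A path from \<open>u\<close> to the root is followed by the reverse of one from
  \<open>v\<close>. Reversal exchanges the ends of each edge, so the hypothesis keeps both in
  \<open>S\<close>.\<close>

lemma connected_from_root:
  assumes "\<And>u. u \<in> S \<Longrightarrow> (\<lambda>a b. E a b \<and> a \<in> S \<and> b \<in> S)\<^sup>*\<^sup>* u c"
    and u: "u \<in> S" "v \<in> S"
  shows "(step_in S)\<^sup>*\<^sup>* u v"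
proof -
  have "(\<lambda>a b. E a b \<and> a \<in> S \<and> b \<in> S)\<^sup>*\<^sup>* c v"
    using assms(1)[OF u(2)]
    by (rule rtranclp_induct) (auto intro: converse_rtranclp_into_rtranclp sym)
  then have "(\<lambda>a b. E a b \<and> a \<in> S \<and> b \<in> S)\<^sup>*\<^sup>* u v"
    using assms(1)[OF u(1)] by (rule rtranclp_trans[rotated])
  then show ?thesis by (rule rtranclp_mono[THEN predicate2D, rotated]) auto
qed

lemma ball_path_to_root:
  assumes "d u \<le> n" "{x. d x \<le> n} \<subseteq> S"
  shows "(\<lambda>a b. E a b \<and> a \<in> S \<and> b \<in> S)\<^sup>*\<^sup>* u c"
  using assms
proof (induction "d u" arbitrary: u)
  case (Suc k)
  then obtain y where "E u y" "d y = k" using ex_parent by metis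
  with Suc show ?case
    by (intro converse_rtranclp_into_rtranclp[of _ u y]) auto
qed auto

text \<open>The ball of radius \<open>n\<close> is connected through the root and avoids
  \<open>x\<close>, so it contains at most one neighbour of \<open>x\<close>.\<close>

lemma unique_parent:
  assumes "d x = Suc n" "E x y" "d y \<le> n" "E x z" "d z \<le> n"
  shows "y = z"
proof (rule unique_neighbour_in_connected_set[where S = "{x. d x \<le> n}"])
  show "(step_in {x. d x \<le> n})\<^sup>*\<^sup>* u v" if "u \<in> {x. d x \<le> n}" "v \<in> {x. d x \<le> n}" for u v
    by (rule connected_from_root[OF ball_path_to_root[of _ n] that]) auto
qed (use assms in auto)

text \<open>If \<open>x\<close> and \<open>y\<close> were adjacent on level n + 1, the ball of
  radius \<open>n\<close> with \<open>y\<close> added would be connected, avoid \<open>x\<close> and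
  contain two neighbours of \<open>x\<close>: its parent and \<open>y\<close>.\<close>

lemma no_same_level_edge:
  assumes "E x y"
  shows "d x \<noteq> d y"
proof
  assume eq: "d x = d y"
  show False
  proof (cases "d x")
    case 0
    then show ?thesis using eq assms irrefl by simp
  next
    case (Suc n)
    obtain z where z: "E x z" "d z = n" using ex_parent Suc by metis
    obtain w where w: "E y w" "d w = n" using ex_parent Suc eq by metis
    let ?S = "insert y {x. d x \<le> n}"
    have root: "(\<lambda>a b. E a b \<and> a \<in> ?S \<and> b \<in> ?S)\<^sup>*\<^sup>* u c" if "u \<in> ?S" for u
    proof (cases "u = y")
      case True
      then show ?thesis
        using w by (intro converse_rtranclp_into_rtranclp[of _ u w] ball_path_to_root[of _ n]) auto
    next
      case False
      then show ?thesis using that by (intro ball_path_to_root[of _ n]) auto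
    qed
    have "y = z"
    proof (rule unique_neighbour_in_connected_set[where S = ?S])
      show "(step_in ?S)\<^sup>*\<^sup>* u v" if "u \<in> ?S" "v \<in> ?S" for u v
        using root that by (rule connected_from_root)
      show "x \<notin> ?S" using Suc assms irrefl by auto
    qed (use assms z in auto)
    then show False using z eq Suc by simp
  qed
qed

lemma neighbour_levels: "E x y \<Longrightarrow> d y = Suc (d x) \<or> d x = Suc (d y)"
  using gdist_adj_le[of x y] gdist_adj_le[of y x] sym[of x y] no_same_level_edge[of x y] by linarith

definition children :: "'v \<Rightarrow> 'v set" where "children x = {y. E x y \<and> d y = Suc (d x)}"

lemma finite_children: "finite (children x)"
  unfolding children_def by (rule finite_subset[OF _ finite_nbrs[of x]]) auto

lemma nbrs_root: "{y. E c y} = children c"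
  unfolding children_def using neighbour_levels[of c] by auto

lemma nbrs_non_root:
  assumes "d x = Suc n"
  obtains y where "d y = n" "{y. E x y} = insert y (children x)" "y \<notin> children x"
proof -
  obtain y where y: "E x y" "d y = n" using ex_parent[OF assms] by auto
  have "z = y \<or> z \<in> children x" if "E x z" for z
  proof (cases "d z = Suc (d x)")
    case False
    then have "d z \<le> n" using neighbour_levels[OF that] assms by auto
    then show ?thesis using unique_parent[OF assms that _ y(1)] y(2) by simp
  qed (use that in \<open>simp add: children_def\<close>)
  then have "{y. E x y} = insert y (children x)"
    using y by (auto simp: children_def)
  then show thesis using y assms by (intro that[of y]) (auto simp: children_def)
qed

lemma card_children_root: "card (children c) = q + 1"
  using card_nbrs[of c] by (simp add: nbrs_root)

lemma card_children: "d x = Suc n \<Longrightarrow> card (children x) = q"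
  by (rule nbrs_non_root) (use card_nbrs[of x] finite_children[of x] in \<open>auto simp: card_insert_disjoint\<close>)

lemma sphere_0: "sphere 0 = {c}"
  by (auto simp: sphere_def)

lemma sphere_Suc: "sphere (Suc n) = (\<Union>x\<in>sphere n. children x)"
proof (intro Set.set_eqI iffI)
  fix y assume "y \<in> sphere (Suc n)"
  then obtain x where "E y x" "d x = n" using ex_parent by (auto simp: sphere_def)
  then show "y \<in> (\<Union>x\<in>sphere n. children x)"
    using sym[of y x] \<open>y \<in> sphere (Suc n)\<close> by (auto simp: sphere_def children_def)
qed (auto simp: sphere_def children_def)

lemma disjoint_children:
  assumes "x \<in> sphere n" "y \<in> sphere n" "x \<noteq> y"
  shows "children x \<inter> children y = {}"
proof (rule equals0I)
  fix z assume "z \<in> children x \<inter> children y"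
  then have "d z = Suc n" "E z x" "E z y" "d x = n" "d y = n"
    using assms sym by (auto simp: sphere_def children_def)
  then show False using unique_parent[of z n x y] assms(3) by simp
qed

lemma finite_sphere: "finite (sphere n)"
  by (induction n) (auto simp: sphere_0 sphere_Suc finite_children)

lemma card_sphere_Suc: "card (sphere (Suc n)) = (q + 1) * q ^ n"
proof (induction n)
  case 0
  show ?case by (simp add: sphere_Suc sphere_0 card_children_root)
next
  case (Suc n)
  have "card (sphere (Suc (Suc n))) = (\<Sum>x\<in>sphere (Suc n). card (children x))"
    unfolding sphere_Suc[of "Suc n"]
    by (rule card_UN_disjoint) (auto simp: finite_sphere finite_children disjoint_children)
  also have "\<dots> = (\<Sum>x\<in>sphere (Suc n). q)"
    by (rule sum.cong) (auto simp: sphere_def card_children)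
  finally show ?case by (simp add: Suc algebra_simps)
qed

lemma sphere_nonempty: "sphere n \<noteq> {}"
proof (cases n)
  case (Suc k)
  have "card (sphere (Suc k)) \<noteq> 0" unfolding card_sphere_Suc using q_pos by simp
  then show ?thesis unfolding Suc by (metis card.empty)
qed (simp add: sphere_0)

lemma gball_0: "gball E c 0 = sphere 0"
  and gball_Suc: "gball E c (Suc r) = gball E c r \<union> sphere (Suc r)"
  and gball_sphere_disjoint: "gball E c r \<inter> sphere (Suc r) = {}"
  by (auto simp: gball_def sphere_def)

lemma finite_gball: "finite (gball E c r)"
  by (induction r) (simp_all add: gball_0 gball_Suc finite_sphere)

lemma sum_gball_Suc: "sum f (gball E c (Suc r)) = sum f (gball E c r) + sum f (sphere (Suc r))"
  unfolding gball_Suc by (rule sum.union_disjoint) (auto simp: finite_gball finite_sphere gball_sphere_disjoint)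

lemma card_gball_Suc: "card (gball E c (Suc r)) = card (gball E c r) + (q + 1) * q ^ r"
  unfolding gball_Suc
  by (subst card_Un_disjoint) (auto simp: finite_gball finite_sphere gball_sphere_disjoint card_sphere_Suc)

text \<open>With the constant 3 the induction step reads q + 4 \<le> 3q, which holds from q = 2
  on.\<close>

lemma card_gball_le:
  assumes "q \<ge> 2"
  shows "card (gball E c r) \<le> 3 * q ^ r"
proof (induction r)
  case 0
  show ?case by (simp add: gball_0 sphere_0)
next
  case (Suc r)
  have "card (gball E c (Suc r)) \<le> (q + 4) * q ^ r"
    using Suc by (simp add: card_gball_Suc algebra_simps)
  also have "\<dots> \<le> (3 * q) * q ^ r" using assms by (intro mult_right_mono) auto
  finally show ?case by simp
qed

section \<open>Spherical functions and the transform of balls\<close>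

text \<open>Values of the spherical function with eigenvalue \<open>k\<close> along a geodesic ray from the root.\<close>

fun radial_eigen :: "complex \<Rightarrow> nat \<Rightarrow> complex" where
  "radial_eigen k 0 = 1"
| "radial_eigen k (Suc 0) = k / (of_nat q + 1)"
| "radial_eigen k (Suc (Suc n)) = (k * radial_eigen k (Suc n) - radial_eigen k n) / of_nat q"

lemma sum_nbrs_radial_root: "(\<Sum>y | E c y. f (d y)) = (of_nat q + 1) * (f 1 :: complex)"
proof -
  have "(\<Sum>y | E c y. f (d y)) = (\<Sum>y\<in>children c. f 1)"
    unfolding nbrs_root by (rule sum.cong) (auto simp: children_def)
  then show ?thesis by (simp add: card_children_root)
qed

lemma sum_nbrs_radial:
  assumes "d x = Suc n"
  shows "(\<Sum>y | E x y. f (d y)) = f n + of_nat q * (f (Suc (Suc n)) :: complex)"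
proof -
  obtain y where y: "d y = n" "{y. E x y} = insert y (children x)" "y \<notin> children x"
    using nbrs_non_root[OF assms] .
  have "(\<Sum>y\<in>children x. f (d y)) = (\<Sum>y\<in>children x. f (Suc (Suc n)))"
    by (rule sum.cong) (auto simp: children_def assms)
  then show ?thesis
    using y by (simp add: finite_children card_children[OF assms])
qed

text \<open>On radial profiles the eigenvalue equation reads (q + 1) f(1) = k f(0) at the root and
  f(n) + q f(n + 2) = k f(n + 1) on level n + 1, a recurrence with a unique solution. The
  equivalence gives both existence and uniqueness, as required by the definite description in
  \<open>spherical\<close>.\<close>

lemma radial_eigenfunction_iff:
  "(radial E c w \<and> w c = 1 \<and> (\<forall>x. (\<Sum>y | E x y. w y) = k * w x)) \<longleftrightarrow> w = (\<lambda>x. radial_eigen k (d x))"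
  (is "?L \<longleftrightarrow> ?R")
proof
  have q0: "(of_nat q :: complex) \<noteq> 0" "(of_nat q + 1 :: complex) \<noteq> 0"
    using q_pos by (simp, metis of_nat_Suc add.commute of_nat_eq_0_iff nat.simps(3))
  show ?L if ?R
  proof (intro conjI allI)
    show "radial E c w" using that by (simp add: radial_def)
    show "w c = 1" using that by simp
    show "(\<Sum>y | E x y. w y) = k * w x" for x
      using that q0 by (cases "d x") (simp_all add: sum_nbrs_radial_root sum_nbrs_radial)
  qed
  show ?R if L: ?L
  proof -
    define f where "f n = w (SOME x. d x = n)" for n
    have w: "w x = f (d x)" for x
    proof -
      have "d (SOME y. d y = d x) = d x" by (rule someI[of _ x]) simp
      then show ?thesis using L unfolding f_def radial_def by metis
    qed
    have eq: "(\<Sum>y | E x y. f (d y)) = k * f (d x)" for x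
      using L by (simp flip: w)
    have "f n = radial_eigen k n" for n
    proof (induction n rule: induct_nat_012)
      case 0
      show ?case using w[of c] L by simp
    next
      case 1
      show ?case using eq[of c] w[of c] L q0 by (simp add: sum_nbrs_radial_root field_simps)
    next
      case (ge2 n)
      obtain x where x: "d x = Suc n" using sphere_nonempty[of "Suc n"] by (auto simp: sphere_def)
      show ?case using eq[of x] ge2 q0 by (simp add: sum_nbrs_radial[OF x] x field_simps)
    qed
    then show ?thesis using w by auto
  qed
qed

definition eigenvalue_at :: "complex \<Rightarrow> complex" where
  "eigenvalue_at l = 2 * complex_of_real (sqrt (real q)) * cos (l * complex_of_real (ln (real q)))"

lemma spherical_eq: "spherical q E c l = (\<lambda>x. radial_eigen (eigenvalue_at l) (d x))"
  unfolding spherical_def radial_eigenfunction_iff eigenvalue_at_def[symmetric] by simp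

lemma spherical_transform_gball:
  "spherical_transform q E c (indicator (gball E c r)) l =
     (\<Sum>x\<in>gball E c r. radial_eigen (eigenvalue_at l) (d x))"
proof -
  have "{x. indicator (gball E c r) x \<noteq> (0 :: complex)} = gball E c r"
    by (auto simp: indicator_def)
  then show ?thesis
    unfolding spherical_transform_def spherical_eq by (simp add: indicator_def)
qed

lemma continuous_on_radial_eigen: "continuous_on UNIV (\<lambda>l. radial_eigen (eigenvalue_at l) n)"
proof -
  have k: "continuous_on UNIV eigenvalue_at"
    unfolding eigenvalue_at_def by (intro continuous_intros)
  have "of_nat q + 1 \<noteq> (0 :: complex)" "of_nat q \<noteq> (0 :: complex)"
    using q_pos by (simp_all, metis of_nat_Suc add.commute of_nat_eq_0_iff nat.simps(3))
  then show ?thesis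
    by (induction n rule: induct_nat_012) (auto intro!: continuous_intros k)
qed

lemma continuous_on_spherical_transform_gball:
  "continuous_on UNIV (spherical_transform q E c (indicator (gball E c r)))"
  unfolding spherical_transform_gball[abs_def]
  by (intro continuous_on_sum continuous_on_radial_eigen)

context
  fixes l \<theta> s :: complex
  defines "\<theta> \<equiv> l * complex_of_real (ln (real q))" and "s \<equiv> complex_of_real (sqrt (real q))"
begin

lemma s_square: "s * s = of_nat q"
  unfolding s_def by (simp flip: of_real_mult)

lemma sin_three_term:
  "sin ((of_nat n + 2) * \<theta>) = 2 * cos \<theta> * sin ((of_nat n + 1) * \<theta>) - sin (of_nat n * \<theta>)"
proof -
  let ?A = "(of_nat n + 1) * \<theta>"
  have "sin ((of_nat n + 2) * \<theta>) = sin (?A + \<theta>)" "sin (of_nat n * \<theta>) = sin (?A - \<theta>)"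
    by (simp_all add: algebra_simps)
  then show ?thesis by (simp only: sin_add sin_diff) (simp add: algebra_simps)
qed

text \<open>Both sides satisfy u(n + 2) = 2 cos \<theta> u(n + 1) - u(n). Keeping sin \<theta> as a
  factor avoids dividing by zero. The difference \<open>of_nat n - 1\<close> is complex, so it is -1
  at n = 0.\<close>

lemma radial_eigen_closed_form:
  "(of_nat q + 1) * s ^ n * radial_eigen (eigenvalue_at l) n * sin \<theta> =
     of_nat q * sin ((of_nat n + 1) * \<theta>) - sin ((of_nat n - 1) * \<theta>)"
proof (induction n rule: induct_nat_012)
  case 0
  show ?case by (simp add: algebra_simps)
next
  case 1
  have q0: "of_nat q + 1 \<noteq> (0 :: complex)"
    by (metis of_nat_Suc add.commute of_nat_eq_0_iff nat.simps(3))
  have "sin ((of_nat (Suc 0) + 1) * \<theta>) = 2 * sin \<theta> * cos \<theta>"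
    using sin_double[of \<theta>] by simp
  moreover have "eigenvalue_at l = 2 * s * cos \<theta>" by (simp add: eigenvalue_at_def s_def \<theta>_def)
  ultimately show ?case
    using q0 by (simp add: s_square[symmetric])
next
  case (ge2 n)
  let ?\<phi> = "radial_eigen (eigenvalue_at l)"
  have "of_nat q \<noteq> (0 :: complex)" using q_pos by simp
  then have "s * s * ?\<phi> (Suc (Suc n)) = 2 * s * cos \<theta> * ?\<phi> (Suc n) - ?\<phi> n"
    by (simp add: eigenvalue_at_def s_def \<theta>_def flip: of_real_mult)
  then have "(of_nat q + 1) * s ^ n * (s * s * ?\<phi> (Suc (Suc n))) * sin \<theta> =
      (of_nat q + 1) * s ^ n * (2 * s * cos \<theta> * ?\<phi> (Suc n) - ?\<phi> n) * sin \<theta>"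
    by simp
  then have "(of_nat q + 1) * s ^ Suc (Suc n) * ?\<phi> (Suc (Suc n)) * sin \<theta> =
      2 * cos \<theta> * ((of_nat q + 1) * s ^ Suc n * ?\<phi> (Suc n) * sin \<theta>)
      - (of_nat q + 1) * s ^ n * ?\<phi> n * sin \<theta>"
    by (simp add: algebra_simps)
  also have "\<dots> = of_nat q * (2 * cos \<theta> * sin ((of_nat (Suc n) + 1) * \<theta>) - sin (of_nat (Suc n) * \<theta>))
      - (2 * cos \<theta> * sin (of_nat n * \<theta>) - sin ((of_nat n - 1) * \<theta>))"
    unfolding ge2 by (simp add: algebra_simps)
  also have "2 * cos \<theta> * sin ((of_nat (Suc n) + 1) * \<theta>) - sin (of_nat (Suc n) * \<theta>) = sin ((of_nat (Suc (Suc n)) + 1) * \<theta>)"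
    using sin_three_term[of "Suc n"] by (simp add: add_ac)
  also have "2 * cos \<theta> * sin (of_nat n * \<theta>) - sin ((of_nat n - 1) * \<theta>) = sin ((of_nat (Suc (Suc n)) - 1) * \<theta>)"
  \<comment> \<open>\<open>sin_three_term\<close> has a natural number as lowest index, so the index
    -1 occurring for n = 0 is handled apart.\<close>
  proof (cases n)
    case (Suc m)
    then show ?thesis using sin_three_term[of m] by (simp add: add_ac)
  qed simp
  finally show ?case .
qed

text \<open>Induction by adding spheres: the sphere of radius r + 1 contributes s^r (s^2 sin ((r +
  2) \<theta>) - sin (r \<theta>)) / s, whose second term cancels the one from the smaller
  ball.\<close>

lemma spherical_transform_gball_closed_form:
  "spherical_transform q E c (indicator (gball E c r)) l * sin \<theta> =
     s ^ r * (sin (of_nat (r + 1) * \<theta>) + sin (of_nat r * \<theta>) / s)"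
proof (induction r)
  case 0
  show ?case unfolding spherical_transform_gball by (simp add: gball_0 sphere_0)
next
  case (Suc r)
  let ?\<phi> = "radial_eigen (eigenvalue_at l)"
  have s0: "s \<noteq> 0" using q_pos by (simp add: s_def)
  have "(\<Sum>x\<in>sphere (Suc r). ?\<phi> (d x)) = (\<Sum>x\<in>sphere (Suc r). ?\<phi> (Suc r))"
    by (rule sum.cong) (auto simp: sphere_def)
  then have sph: "(\<Sum>x\<in>sphere (Suc r). ?\<phi> (d x)) = (of_nat q + 1) * (s * s) ^ r * ?\<phi> (Suc r)"
    by (simp add: card_sphere_Suc s_square algebra_simps)
  have "s * ((\<Sum>x\<in>sphere (Suc r). ?\<phi> (d x)) * sin \<theta>) =
      s ^ r * ((of_nat q + 1) * s ^ Suc r * ?\<phi> (Suc r) * sin \<theta>)"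
    unfolding sph by (simp add: power_mult_distrib mult_ac)
  also have "\<dots> = s ^ r * (s * s * sin ((of_nat (Suc r) + 1) * \<theta>) - sin (of_nat r * \<theta>))"
    unfolding radial_eigen_closed_form s_square by simp
  finally have *: "(\<Sum>x\<in>sphere (Suc r). ?\<phi> (d x)) * sin \<theta> =
      s ^ r * (s * s * sin ((of_nat (Suc r) + 1) * \<theta>) - sin (of_nat r * \<theta>)) / s"
    using s0 by (simp add: field_simps)
  have "spherical_transform q E c (indicator (gball E c (Suc r))) l * sin \<theta> =
      spherical_transform q E c (indicator (gball E c r)) l * sin \<theta> + (\<Sum>x\<in>sphere (Suc r). ?\<phi> (d x)) * sin \<theta>"
    by (simp add: spherical_transform_gball sum_gball_Suc ring_distribs)
  also have "\<dots> = s ^ Suc r * (sin (of_nat (Suc r + 1) * \<theta>) + sin (of_nat (Suc r) * \<theta>) / s)"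
    unfolding * Suc using s0 by (simp add: field_simps)
  finally show ?case .
qed

end

section \<open>Lower bounds for the number variance\<close>

lemma cmod_spherical_transform_gball_ge:
  fixes l :: real
  shows "sqrt q ^ r * \<bar>sin (real (r + 1) * (l * ln q)) + sin (real r * (l * ln q)) / sqrt q\<bar>
           \<le> cmod (spherical_transform q E c (indicator (gball E c r)) (of_real l))"
    (is "?a * \<bar>?b\<bar> \<le> cmod ?T")
proof -
  have arg: "of_nat n * complex_of_real x = of_real (real n * x)"
    "complex_of_real l * complex_of_real (ln q) = of_real (l * ln q)" for n x
    by simp_all
  have "?T * of_real (sin (l * ln q)) = of_real (?a * ?b)"
    using spherical_transform_gball_closed_form[of r "of_real l"]
    unfolding arg sin_of_real by simp
  then have "cmod (?T * of_real (sin (l * ln q))) = cmod (of_real (?a * ?b))" by (simp only:)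
  then have "cmod ?T * \<bar>sin (l * ln q)\<bar> = ?a * \<bar>?b\<bar>"
    unfolding norm_mult norm_of_real abs_mult by simp
  moreover have "cmod ?T * \<bar>sin (l * ln q)\<bar> \<le> cmod ?T"
    by (rule mult_left_le) auto
  ultimately show ?thesis by linarith
qed

text \<open>The integrand is nonnegative and the real point \<open>l\<close> lies in
  \<open>Lambda_star q\<close>, so restricting the integral to this point only decreases it.\<close>

lemma NV_star_ge_atom:
  fixes l :: real
  assumes fin: "finite_measure \<sigma>" and sets: "sets \<sigma> = sets (restrict_space borel (Lambda q))"
    and l: "0 < l" "l < pi / ln (real q)"
  shows "measure \<sigma> {complex_of_real l} * (cmod (spherical_transform q E c (indicator (gball E c r)) (of_real l)))\<^sup>2
           \<le> NV_star q E c \<sigma> r"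
proof -
  interpret finite_measure \<sigma> by fact
  define f where "f z = (cmod (spherical_transform q E c (indicator (gball E c r)) z))\<^sup>2" for z
  have space: "space \<sigma> = Lambda q"
    using sets_eq_imp_space_eq[OF sets] by (simp add: space_restrict_space)
  have in_sets: "A \<inter> Lambda q \<in> sets \<sigma>" if "A \<in> sets borel" for A
    unfolding sets sets_restrict_space using that by (auto simp: Int_commute)
  have cont: "continuous_on UNIV f"
    unfolding f_def by (intro continuous_intros continuous_on_spherical_transform_gball)
  then have "f \<in> borel_measurable \<sigma>"
    unfolding measurable_cong_sets[OF sets refl]
    by (intro measurable_restrict_space1 borel_measurable_continuous_onI)
  \<comment> \<open>Integrability has to be secured, since a non-integrable function would have
    integral 0. The integrand is continuous and \<open>Lambda q\<close> lies in a disc: real parts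
    are at most pi / log q and imaginary parts at most 1/2.\<close>
  define R where "R = pi / ln (real q) + 1"
  have "Lambda q \<subseteq> cball 0 R"
  proof
    fix z assume "z \<in> Lambda q"
    then have "\<bar>Re z\<bar> \<le> pi / ln (real q)" "\<bar>Im z\<bar> \<le> 1"
      using l by (auto simp: Lambda_def simp del: Re_divide_of_real)
    then show "z \<in> cball 0 R"
      using cmod_le[of z] unfolding R_def by simp
  qed
  moreover have "bounded (f ` cball 0 R)"
    by (intro compact_imp_bounded compact_continuous_image continuous_on_subset[OF cont]) auto
  ultimately obtain B where B: "\<And>z. z \<in> Lambda q \<Longrightarrow> norm (f z) \<le> B"
    unfolding bounded_iff by blast
  then have int: "integrable \<sigma> f"
    using \<open>f \<in> borel_measurable \<sigma>\<close> by (intro integrable_const_bound[where B = B]) (auto simp: space)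
  have mem: "complex_of_real l \<in> Lambda_star q"
    using l by (auto simp: Lambda_star_def Lambda_def complex_eq_iff)
  then have sing: "{complex_of_real l} \<in> sets \<sigma>"
    using in_sets[of "{complex_of_real l}"] by (simp add: Lambda_star_def)
  have "Lambda_star q = (- {\<i> / 2, complex_of_real (pi / ln (real q)) + \<i> / 2}) \<inter> Lambda q"
    unfolding Lambda_star_def by blast
  then have star: "Lambda_star q \<in> sets \<sigma>"
    using in_sets by simp
  have "measure \<sigma> {complex_of_real l} * f (of_real l)
      = (LINT z|\<sigma>. indicator {complex_of_real l} z * f (of_real l))"
    using sing by (simp add: Int_absorb2 sets.sets_into_space)
  also have "\<dots> \<le> (LINT z|\<sigma>. indicator (Lambda_star q) z *\<^sub>R f z)"
  proof (rule integral_mono)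
    show "integrable \<sigma> (\<lambda>z. indicator {complex_of_real l} z * f (of_real l))"
      using sing by (intro integrable_mult_left) (simp add: integrable_indicator_iff emeasure_finite less_top[symmetric])
    show "integrable \<sigma> (\<lambda>z. indicator (Lambda_star q) z *\<^sub>R f z)"
      using star int by (rule integrable_mult_indicator)
    show "indicator {complex_of_real l} z * f (of_real l) \<le> indicator (Lambda_star q) z *\<^sub>R f z" for z
      using mem by (auto simp: indicator_def f_def)
  qed
  finally show ?thesis unfolding NV_star_def set_lebesgue_integral_def f_def .
qed

end

theorem theorem1p4:
  fixes q :: nat and E :: "'v \<Rightarrow> 'v \<Rightarrow> bool" and c :: 'v
    and \<mu> :: "('v \<Rightarrow> real) measure" and \<sigma> :: "complex measure" and l :: real
  assumes "q \<ge> 2"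
    and "is_tree E" and "is_regular (q + 1) E"
    and "point_process \<mu>" and "invariant_process E \<mu>" and "locally_square_integrable \<mu>"
    and "is_diffraction_measure q E c \<mu> \<sigma>"
    and "l \<in> Lambda_rat q" and "measure \<sigma> {complex_of_real l} > 0"
  shows "liminf (\<lambda>r. ereal (NV_star q E c \<sigma> r / real (card (gball E c r)))) > 0"
proof -
  interpret regular_tree q E c
    using assms(1-3) by unfold_locales auto
  have ln: "ln (real q) > 0" using assms(1) by simp
  obtain t where l: "0 < l" "l < pi / ln (real q)" and t: "t \<in> \<rat>" "l = pi / ln (real q) * t"
    using assms(8) unfolding Lambda_rat_def Let_def by (auto split: if_splits)
  define \<theta> where "\<theta> = l * ln (real q)"
  have \<theta>: "\<theta> = pi * t" using ln by (simp add: \<theta>_def t(2))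
  have "0 < \<theta>" "\<theta> < pi" using l ln by (simp_all add: \<theta>_def field_simps)
  then have t01: "0 < t" "t < 1" by (simp_all add: \<theta> zero_less_mult_iff)
  have nz: "sin (real (r + 1) * \<theta>) + sin (real r * \<theta>) / sqrt q \<noteq> 0" for r
  proof
    assume "sin (real (r + 1) * \<theta>) + sin (real r * \<theta>) / sqrt q = 0"
    from sine_recurrence_zero_rational_angle[OF assms(1) t(1) t01 \<theta> this]
    have ex: "(q = 2 \<and> \<theta> \<in> {3 * pi / 4, 5 * pi / 12, 11 * pi / 12}) \<or> (q = 3 \<and> \<theta> = 5 * pi / 6)" .
    \<comment> \<open>Dividing the exceptional angles by log q gives exactly the points removed in
      \<open>Lambda_rat\<close>.\<close>
    have l_eq: "l = \<theta> / ln (real q)" using ln by (simp add: \<theta>_def)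
    have not2: "q = 2 \<Longrightarrow> l \<notin> (\<lambda>u. u / ln 2) ` {3 * pi / 4, 5 * pi / 12, 11 * pi / 12}"
      and not3: "q = 3 \<Longrightarrow> l \<noteq> 5 * pi / 6 / ln 3"
      using assms(8) by (simp_all add: Lambda_rat_def)
    from ex show False
    proof (elim disjE conjE)
      assume "q = 2" and *: "\<theta> \<in> {3 * pi / 4, 5 * pi / 12, 11 * pi / 12}"
      then have "l = \<theta> / ln 2" using l_eq by simp
      then show False using not2[OF \<open>q = 2\<close>] * by blast
    next
      assume q3: "q = 3" and \<theta>3: "\<theta> = 5 * pi / 6"
      have "l = 5 * pi / 6 / ln 3" unfolding l_eq \<theta>3 q3 by simp
      then show False using not3[OF q3] by contradiction
    qed
  qed
  obtain \<delta> where \<delta>: "\<delta> > 0"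
    "\<And>r. \<delta> \<le> \<bar>sin (real (r + 1) * \<theta>) + sin (real r * \<theta>) / sqrt q\<bar>"
    by (rule sine_recurrence_bounded_below_rational_angle[OF t(1) t01(1) \<theta> nz]) blast
  \<comment> \<open>The squared transform at \<open>l\<close> is at least q^r \<delta>^2 and the
    ball has at most 3 q^r points, so q^r cancels and the 3 remains. The bound is uniform in
    \<open>r\<close> and passes to the lower limit.\<close>
  define C where "C = measure \<sigma> {complex_of_real l} * \<delta>\<^sup>2 / 3"
  have "C > 0" using assms(9) \<delta>(1) by (simp add: C_def)
  have "C \<le> NV_star q E c \<sigma> r / real (card (gball E c r))" for r
  proof -
    have card: "0 < real (card (gball E c r))" "real (card (gball E c r)) \<le> 3 * real q ^ r"
    proof -
      have "c \<in> gball E c r" by (simp add: gball_def)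
      then show "0 < real (card (gball E c r))" using finite_gball by (auto simp: card_gt_0_iff)
      have "real (card (gball E c r)) \<le> real (3 * q ^ r)"
        using card_gball_le[OF assms(1)] by (rule of_nat_mono)
      then show "real (card (gball E c r)) \<le> 3 * real q ^ r" by simp
    qed
    let ?T = "cmod (spherical_transform q E c (indicator (gball E c r)) (of_real l))"
    have "sqrt q ^ r * \<delta> \<le> ?T"
      using mult_left_mono[OF \<delta>(2)[of r], of "sqrt q ^ r"] cmod_spherical_transform_gball_ge[of r l]
      unfolding \<theta>_def by (simp del: of_nat_add)
    then have "(sqrt q ^ r * \<delta>)\<^sup>2 \<le> ?T\<^sup>2" using \<delta>(1) by (intro power_mono) auto
    moreover have "(sqrt q ^ r * \<delta>)\<^sup>2 = real q ^ r * \<delta>\<^sup>2"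
      by (simp add: power_mult_distrib power_mult[symmetric] mult.commute[of r])
        (simp add: power_mult)
    ultimately have "measure \<sigma> {complex_of_real l} * (real q ^ r * \<delta>\<^sup>2) \<le> measure \<sigma> {complex_of_real l} * ?T\<^sup>2"
      by (intro mult_left_mono) auto
    also have "\<dots> \<le> NV_star q E c \<sigma> r"
      using assms(7) l by (intro NV_star_ge_atom) (auto simp: is_diffraction_measure_def)
    finally have "C * (3 * real q ^ r) \<le> NV_star q E c \<sigma> r"
      by (simp add: C_def mult_ac)
    moreover have "C * real (card (gball E c r)) \<le> C * (3 * real q ^ r)"
      using card(2) \<open>C > 0\<close> by (intro mult_left_mono) auto
    ultimately show ?thesis using card(1) by (simp add: field_simps)
  qed
  then have "ereal C \<le> liminf (\<lambda>r. ereal (NV_star q E c \<sigma> r / real (card (gball E c r))))"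
    by (intro Liminf_bounded always_eventually) simp
  then show ?thesis using \<open>C > 0\<close> by (meson ereal_less(2) less_le_trans)
qed

end
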